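(* Let $N\ge2$. For any vector $\boldsymbol{x}\in(\mathbb{R}\setminus\{0\})^N$, the maps $f_{\boldsymbol{x}}(M)=\mathrm{diag}(\boldsymbol{x})\,M$ and $g_{\boldsymbol{x}}(M)=M\,\mathrm{diag}(\boldsymbol{x})$ are permutations of $\mathcal{C}_L^N$ and permutations of $\mathcal{C}_U^N$; that is, each of $f_{\boldsymbol{x}}$ and $g_{\boldsymbol{x}}$ maps $\mathcal{C}_L^N$ bijectively onto itself and maps $\mathcal{C}_U^N$ bijectively onto itself.
   Context: The set $\mathcal{C}_L^N$ of L-CoLT (lower-collinear triangular) matrices consists of all $M=[m_{i,j}]\in\mathbb{R}^{N\times N}$ with $m_{i,j}=0$ for $i<j$ such that there is a vector $\boldsymbol{r}\in(\mathbb{R}\setminus\{0\})^{N-1}$ with $m_{i+1,j}/m_{i,j}=r_i$ for all $1\le j\le i\le N-1$ (in particular the denominators are nonzero). The set $\mathcal{C}_U^N$ of U-CoLT (upper-collinear triangular) matrices consists of all $M=[m_{i,j}]\in\mathbb{R}^{N\times N}$ with $m_{i,j}=0$ for $i\ge j$ such that there is a vector $\boldsymbol{r}'\in(\mathbb{R}\setminus\{0\})^{N-2}$ with $m_{i-1,j}/m_{i,j}=r'_{i-1}$ for all $2\le i<j\le N$ (in particular the denominators are nonzero). $\mathrm{diag}(\boldsymbol{x})$ is the diagonal matrix with diagonal $\boldsymbol{x}$. *)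

theory Defs
  imports Complex_Main "Jordan_Normal_Form.Matrix"
begin

text \<open>
  Matrices and vectors are indexed from 0, so \<open>M $$ (i, j)\<close> is the entry
  \<open>m\<^bsub>i+1,j+1\<^esub>\<close> of the 1-based notation and \<open>r $ i\<close> is \<open>r\<^bsub>i+1\<^esub>\<close>.
\<close>

definition nonzero_vecs :: "nat \<Rightarrow> real vec set" where
  "nonzero_vecs n = {x \<in> carrier_vec n. \<forall>i<n. x $ i \<noteq> 0}"

text \<open>
  As division by 0 yields 0, the nonvanishing of the denominators is demanded explicitly.
  The entry \<open>m\<^bsub>N,N\<^esub>\<close> of an L-CoLT matrix, and the entry \<open>m\<^bsub>1,2\<^esub>\<close> of a U-CoLT matrix
  occur in no ratio and are arbitrary reals.
\<close>

definition L_CoLT :: "nat \<Rightarrow> real mat set" where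
  "L_CoLT N = {M \<in> carrier_mat N N.
     (\<forall>i<N. \<forall>j<N. i < j \<longrightarrow> M $$ (i, j) = 0) \<and>
     (\<exists>r \<in> nonzero_vecs (N - 1). \<forall>i j. j \<le> i \<and> i < N - 1 \<longrightarrow>
        M $$ (i, j) \<noteq> 0 \<and> M $$ (i + 1, j) / M $$ (i, j) = r $ i)}"

text \<open>
  Below, row \<open>i\<close> is the numerator row: the pair \<open>(i, i + 1)\<close> stands for the 1-based rows
  \<open>i' - 1\<close> and \<open>i'\<close> with \<open>i' = i + 2\<close>, and \<open>r $ i\<close> is \<open>r'\<^bsub>i'-1\<^esub>\<close>.
\<close>

definition U_CoLT :: "nat \<Rightarrow> real mat set" where
  "U_CoLT N = {M \<in> carrier_mat N N.
     (\<forall>i<N. \<forall>j<N. i \<ge> j \<longrightarrow> M $$ (i, j) = 0) \<and>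
     (\<exists>r \<in> nonzero_vecs (N - 2). \<forall>i j. i + 1 < j \<and> j < N \<longrightarrow>
        M $$ (i + 1, j) \<noteq> 0 \<and> M $$ (i, j) / M $$ (i + 1, j) = r $ i)}"

end

theory Submission
  imports Defs
begin

text \<open>A diagonal factor on the left scales rows, one on the right scales columns. Membership
  in either class is a zero pattern together with the condition that the ratio of two consecutive
  rows is nonzero and the same in all relevant columns. Scaling rows by nonzero numbers multiplies
  each such ratio by a nonzero constant independent of the column; scaling columns cancels in every
  ratio. Hence both classes are stable under all invertible diagonal factors, on either side. The
  inverse of such a factor is again one, so multiplying by it stays in the class and undoes the map;
  \<open>bij_betw_mult_left_inverse_mat\<close> and \<open>bij_betw_mult_right_inverse_mat\<close>
  turn this into bijectivity.\<close>

lemma mat_diag_inverse: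
  fixes d :: "nat \<Rightarrow> 'a :: field"
  assumes "\<And>i. i < n \<Longrightarrow> d i \<noteq> 0"
  shows "mat_diag n d * mat_diag n (\<lambda>i. inverse (d i)) = 1\<^sub>m n"
    and "mat_diag n (\<lambda>i. inverse (d i)) * mat_diag n d = 1\<^sub>m n"
  using assms by (simp_all, auto simp: mat_diag_def)

text \<open>Row \<open>i\<close> is scaled by \<open>d i\<close>, so the ratio of row
  \<open>i + 1\<close> to row \<open>i\<close> picks up the factor \<open>d (i + 1) / d i\<close>,
  whatever the column. The scaling is an arbitrary function \<open>d\<close> so that the result
  serves both a diagonal matrix and its inverse.\<close>

lemma mat_diag_mult_L_CoLT:
  assumes d: "\<And>i. i < N \<Longrightarrow> d i \<noteq> 0" and M: "M \<in> L_CoLT N"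
  shows "mat_diag N d * M \<in> L_CoLT N"
proof -
  have carrier: "M \<in> carrier_mat N N" using M by (simp add: L_CoLT_def)
  obtain r where r: "r \<in> nonzero_vecs (N - 1)"
    and ratio: "\<And>i j. j \<le> i \<Longrightarrow> i < N - 1 \<Longrightarrow>
      M $$ (i, j) \<noteq> 0 \<and> M $$ (i + 1, j) / M $$ (i, j) = r $ i"
    using M by (auto simp: L_CoLT_def)
  define s where "s = vec (N - 1) (\<lambda>i. d (i + 1) / d i * r $ i)"
  have "s \<in> nonzero_vecs (N - 1)"
    using r d by (auto simp: s_def nonzero_vecs_def)
  moreover have "(mat_diag N d * M) $$ (i, j) \<noteq> 0 \<and>
      (mat_diag N d * M) $$ (i + 1, j) / (mat_diag N d * M) $$ (i, j) = s $ i"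
    if "j \<le> i" "i < N - 1" for i j
    using that d[of i] ratio[OF that]
    by (auto simp: mat_diag_mult_left[OF carrier] s_def field_simps)
  ultimately show ?thesis
    using M carrier by (auto simp: L_CoLT_def mat_diag_mult_left[OF carrier])
qed

text \<open>Both entries of a ratio lie in column \<open>j\<close> and gain the same factor
  \<open>d j\<close>, so the old witness \<open>r\<close> still works.\<close>

lemma mult_mat_diag_L_CoLT:
  assumes d: "\<And>i. i < N \<Longrightarrow> d i \<noteq> 0" and M: "M \<in> L_CoLT N"
  shows "M * mat_diag N d \<in> L_CoLT N"
proof -
  have carrier: "M \<in> carrier_mat N N" using M by (simp add: L_CoLT_def)
  obtain r where r: "r \<in> nonzero_vecs (N - 1)"
    and ratio: "\<And>i j. j \<le> i \<Longrightarrow> i < N - 1 \<Longrightarrow>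
      M $$ (i, j) \<noteq> 0 \<and> M $$ (i + 1, j) / M $$ (i, j) = r $ i"
    using M by (auto simp: L_CoLT_def)
  have "(M * mat_diag N d) $$ (i, j) \<noteq> 0 \<and>
      (M * mat_diag N d) $$ (i + 1, j) / (M * mat_diag N d) $$ (i, j) = r $ i"
    if "j \<le> i" "i < N - 1" for i j
    using that d[of j] ratio[OF that] by (auto simp: mat_diag_mult_right[OF carrier])
  with r show ?thesis
    using M carrier by (auto simp: L_CoLT_def mat_diag_mult_right[OF carrier])
qed

lemma mat_diag_mult_U_CoLT:
  assumes d: "\<And>i. i < N \<Longrightarrow> d i \<noteq> 0" and M: "M \<in> U_CoLT N"
  shows "mat_diag N d * M \<in> U_CoLT N"
proof -
  have carrier: "M \<in> carrier_mat N N" using M by (simp add: U_CoLT_def)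
  obtain r where r: "r \<in> nonzero_vecs (N - 2)"
    and ratio: "\<And>i j. i + 1 < j \<Longrightarrow> j < N \<Longrightarrow>
      M $$ (i + 1, j) \<noteq> 0 \<and> M $$ (i, j) / M $$ (i + 1, j) = r $ i"
    using M by (auto simp: U_CoLT_def)
  \<comment> \<open>The factor is inverted compared with the lower triangular case, since here row
    \<open>i\<close> is the numerator and row \<open>i + 1\<close> the denominator.\<close>
  define s where "s = vec (N - 2) (\<lambda>i. d i / d (i + 1) * r $ i)"
  have "s \<in> nonzero_vecs (N - 2)"
    using r d by (auto simp: s_def nonzero_vecs_def)
  moreover have "(mat_diag N d * M) $$ (i + 1, j) \<noteq> 0 \<and>
      (mat_diag N d * M) $$ (i, j) / (mat_diag N d * M) $$ (i + 1, j) = s $ i"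
    if "i + 1 < j" "j < N" for i j
    \<comment> \<open>The bounds \<open>i + 1 < j\<close> and \<open>j < N\<close> give
      \<open>i < N - 2\<close>, so \<open>s $ i\<close> is within range.\<close>
    using that d[of "i + 1"] ratio[OF that]
    by (auto simp: mat_diag_mult_left[OF carrier] s_def field_simps)
  ultimately show ?thesis
    using M carrier by (auto simp: U_CoLT_def mat_diag_mult_left[OF carrier])
qed

lemma mult_mat_diag_U_CoLT:
  assumes d: "\<And>i. i < N \<Longrightarrow> d i \<noteq> 0" and M: "M \<in> U_CoLT N"
  shows "M * mat_diag N d \<in> U_CoLT N"
proof -
  have carrier: "M \<in> carrier_mat N N" using M by (simp add: U_CoLT_def)
  obtain r where r: "r \<in> nonzero_vecs (N - 2)"
    and ratio: "\<And>i j. i + 1 < j \<Longrightarrow> j < N \<Longrightarrow>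
      M $$ (i + 1, j) \<noteq> 0 \<and> M $$ (i, j) / M $$ (i + 1, j) = r $ i"
    using M by (auto simp: U_CoLT_def)
  have "(M * mat_diag N d) $$ (i + 1, j) \<noteq> 0 \<and>
      (M * mat_diag N d) $$ (i, j) / (M * mat_diag N d) $$ (i + 1, j) = r $ i"
    if "i + 1 < j" "j < N" for i j
    using that d[of j] ratio[OF that] by (auto simp: mat_diag_mult_right[OF carrier])
  with r show ?thesis
    using M carrier by (auto simp: U_CoLT_def mat_diag_mult_right[OF carrier])
qed

text \<open>Stability under \<open>B\<close> as well as \<open>A\<close> is what yields
  surjectivity: the preimage \<open>B * M\<close> of \<open>M\<close> must lie in
  \<open>S\<close>.\<close>

lemma bij_betw_mult_left_inverse_mat:
  fixes S :: "'a :: semiring_1 mat set"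
  assumes "S \<subseteq> carrier_mat n m" "A \<in> carrier_mat n n" "B \<in> carrier_mat n n"
    and "A * B = 1\<^sub>m n" "B * A = 1\<^sub>m n"
    and "\<And>M. M \<in> S \<Longrightarrow> A * M \<in> S" "\<And>M. M \<in> S \<Longrightarrow> B * M \<in> S"
  shows "bij_betw (\<lambda>M. A * M) S S"
proof (rule bij_betw_byWitness[where f' = "\<lambda>M. B * M"])
  \<comment> \<open>Associativity is used from right to left, to bring \<open>B\<close> and
    \<open>A\<close> together so that they cancel.\<close>
  show "\<forall>M\<in>S. B * (A * M) = M" "\<forall>M\<in>S. A * (B * M) = M"
    using assms(1-5) by (auto dest!: subsetD simp flip: assoc_mult_mat[of _ n n _ n _ m])
qed (use assms in auto)

lemma bij_betw_mult_right_inverse_mat: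
  fixes S :: "'a :: semiring_1 mat set"
  assumes "S \<subseteq> carrier_mat m n" "A \<in> carrier_mat n n" "B \<in> carrier_mat n n"
    and "A * B = 1\<^sub>m n" "B * A = 1\<^sub>m n"
    and "\<And>M. M \<in> S \<Longrightarrow> M * A \<in> S" "\<And>M. M \<in> S \<Longrightarrow> M * B \<in> S"
  shows "bij_betw (\<lambda>M. M * A) S S"
proof (rule bij_betw_byWitness[where f' = "\<lambda>M. M * B"])
  show "\<forall>M\<in>S. M * A * B = M" "\<forall>M\<in>S. M * B * A = M"
    using assms(1-5) by (auto dest!: subsetD simp: assoc_mult_mat[of _ m n _ n _ n])
qed (use assms in auto)

theorem theorem3p6:
  fixes N :: nat and x :: "real vec"
  assumes "N \<ge> 2" and "x \<in> nonzero_vecs N"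
  shows "bij_betw (\<lambda>M. mat_diag N (\<lambda>i. x $ i) * M) (L_CoLT N) (L_CoLT N)
    \<and> bij_betw (\<lambda>M. M * mat_diag N (\<lambda>i. x $ i)) (L_CoLT N) (L_CoLT N)
    \<and> bij_betw (\<lambda>M. mat_diag N (\<lambda>i. x $ i) * M) (U_CoLT N) (U_CoLT N)
    \<and> bij_betw (\<lambda>M. M * mat_diag N (\<lambda>i. x $ i)) (U_CoLT N) (U_CoLT N)"
proof -
  let ?D = "mat_diag N (\<lambda>i. x $ i)" and ?E = "mat_diag N (\<lambda>i. inverse (x $ i))"
  \<comment> \<open>\<open>inv_x\<close> lets the stability lemmas apply to the inverse factor
    \<open>?E\<close> too.\<close>
  have x: "x $ i \<noteq> 0" and inv_x: "inverse (x $ i) \<noteq> 0" if "i < N" for i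
    using assms(2) that by (auto simp: nonzero_vecs_def)
  have sub: "L_CoLT N \<subseteq> carrier_mat N N" "U_CoLT N \<subseteq> carrier_mat N N"
    by (auto simp: L_CoLT_def U_CoLT_def)
  have DE: "?D * ?E = 1\<^sub>m N" "?E * ?D = 1\<^sub>m N"
    by (rule mat_diag_inverse, erule x)+
  note left = bij_betw_mult_left_inverse_mat[OF _ mat_diag_dim mat_diag_dim DE]
  note right = bij_betw_mult_right_inverse_mat[OF _ mat_diag_dim mat_diag_dim DE]
  show ?thesis
    by (intro conjI left[OF sub(1)] left[OF sub(2)] right[OF sub(1)] right[OF sub(2)]
        mat_diag_mult_L_CoLT mult_mat_diag_L_CoLT mat_diag_mult_U_CoLT mult_mat_diag_U_CoLT
        x inv_x)
qed

end
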